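(* Let $\mathcal{A}$ be a copositive tensor of order $k$ and dimension $n$. If $\lambda$ is an H$^+$-eigenvalue of $\mathcal{A}$, then $\lambda \ge 0$.
   Context: A real $k$th order $n$-dimensional tensor is an array $\mathcal{A}=(a_{i_1\cdots i_k})$ of real numbers, $i_1,\dots,i_k\in\{1,\dots,n\}$; it is symmetric if its entries are invariant under every permutation of the indices. For a vector $x$, $\mathcal{A}x^k = \sum_{i_1,\dots,i_k=1}^n a_{i_1\cdots i_k}x_{i_1}\cdots x_{i_k}$; $\mathcal{A}x^{k-1}$ is the $n$-dimensional vector with $i$th component $(\mathcal{A}x^{k-1})_i=\sum_{i_2,\dots,i_k=1}^n a_{ii_2\cdots i_k}x_{i_2}\cdots x_{i_k}$; and $x^{[k-1]}$ is the vector with $i$th component $x_i^{k-1}$. $\mathbb{R}^n_+$ is the set of vectors in $\mathbb{R}^n$ with all components nonnegative. A copositive tensor is a real symmetric tensor $\mathcal{A}$ with $\mathcal{A}x^k\ge 0$ for all $x\in\mathbb{R}^n_+$. A real number $\lambda$ is an H$^+$-eigenvalue of $\mathcal{A}$ if there is a nonzero $x\in\mathbb{R}^n_+$ with $\mathcal{A}x^{k-1}=\lambda x^{[k-1]}$. *)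

theory Defs
  imports "HOL-Analysis.Analysis" "HOL-Combinatorics.Permutations"
begin

text \<open>
  An index tuple \<open>(i\<^sub>1, \<dots>, i\<^sub>k)\<close> is a list of length \<open>k\<close> over the finite index type \<open>'n\<close>, so the
  dimension is \<open>CARD('n)\<close>. An array of order \<open>k\<close> is a function on such lists; all definitions
  below look only at its values on lists of length \<open>k\<close>. The order is assumed positive wherever
  \<open>k - 1\<close> occurs.
\<close>

type_synonym 'n tensor = "'n list \<Rightarrow> real"

definition symmetric_tensor :: "nat \<Rightarrow> 'n tensor \<Rightarrow> bool" where
  "symmetric_tensor k A \<longleftrightarrow>
     (\<forall>is p. length is = k \<and> p permutes {..<k} \<longrightarrow> A (permute_list p is) = A is)"

definition tensor_form :: "nat \<Rightarrow> 'n::finite tensor \<Rightarrow> real ^ 'n \<Rightarrow> real" where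
  "tensor_form k A x = (\<Sum>is | length is = k. A is * (\<Prod>j<k. x $ (is ! j)))"

definition tensor_map :: "nat \<Rightarrow> 'n::finite tensor \<Rightarrow> real ^ 'n \<Rightarrow> real ^ 'n" where
  "tensor_map k A x =
     (\<chi> i. \<Sum>is | length is = k - 1. A (i # is) * (\<Prod>j<k - 1. x $ (is ! j)))"

definition vec_power :: "real ^ 'n \<Rightarrow> nat \<Rightarrow> real ^ 'n" where
  "vec_power x m = (\<chi> i. (x $ i) ^ m)"

definition nonneg_orthant :: "(real ^ 'n) set" where
  "nonneg_orthant = {x. \<forall>i. 0 \<le> x $ i}"

definition copositive_tensor :: "nat \<Rightarrow> 'n::finite tensor \<Rightarrow> bool" where
  "copositive_tensor k A \<longleftrightarrow>
     symmetric_tensor k A \<and> (\<forall>x\<in>nonneg_orthant. 0 \<le> tensor_form k A x)"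

definition Hplus_eigenvalue :: "nat \<Rightarrow> 'n::finite tensor \<Rightarrow> real \<Rightarrow> bool" where
  "Hplus_eigenvalue k A lam \<longleftrightarrow>
     (\<exists>x\<in>nonneg_orthant. x \<noteq> 0 \<and> tensor_map k A x = lam *\<^sub>R vec_power x (k - 1))"

end

theory Submission
  imports Defs
begin

text \<open>
  Pairing \<open>\<A>x\<^sup>k\<^sup>-\<^sup>1 = \<lambda>x\<^sup>[\<^sup>k\<^sup>-\<^sup>1\<^sup>]\<close> with \<open>x\<close> gives \<open>\<A>x\<^sup>k = \<lambda> \<Sum>\<^sub>i x\<^sub>i\<^sup>k\<close>. The left side is nonnegative by
  copositivity, and the sum is positive because \<open>x\<close> is nonnegative and nonzero.
\<close>

text \<open>Splitting each index tuple into head \<open>i\<close> and tail \<open>is\<close> pulls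
  the factor \<open>x $ i\<close> out of the product.\<close>

lemma tensor_form_Suc: "tensor_form (Suc m) A x = x \<bullet> tensor_map (Suc m) A x"
proof -
  have lists: "{is :: 'a list. length is = Suc m} = (\<lambda>(i, is). i # is) ` (UNIV \<times> {is. length is = m})"
    by (auto simp: length_Suc_conv image_iff)
  have "tensor_form (Suc m) A x
      = (\<Sum>(i, is)\<in>UNIV \<times> {is. length is = m}. A (i # is) * (\<Prod>j<Suc m. x $ ((i # is) ! j)))"
    unfolding tensor_form_def lists
    by (subst sum.reindex) (auto simp: inj_on_def case_prod_unfold simp del: prod.lessThan_Suc)
  also have "\<dots> = (\<Sum>i\<in>UNIV. \<Sum>is | length is = m. x $ i * (A (i # is) * (\<Prod>j<m. x $ (is ! j))))"
    \<comment> \<open>The product is peeled at \<open>j = 0\<close>, the factor of the head;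
      \<open>prod.lessThan_Suc\<close> would peel the last index instead.\<close>
    by (simp add: sum.cartesian_product prod.lessThan_Suc_shift mult_ac del: prod.lessThan_Suc)
  also have "\<dots> = x \<bullet> tensor_map (Suc m) A x"
    by (simp add: inner_vec_def tensor_map_def sum_distrib_left)
  finally show ?thesis .
qed

lemma inner_vec_power: "x \<bullet> vec_power x m = (\<Sum>i\<in>UNIV. (x $ i) ^ Suc m)"
  by (simp add: inner_vec_def vec_power_def)

text \<open>One nonzero coordinate gives a positive term, and no other term is negative.\<close>

lemma sum_power_pos:
  fixes x :: "real ^ 'n::finite"
  assumes "x \<in> nonneg_orthant" and "x \<noteq> 0"
  shows "0 < (\<Sum>i\<in>UNIV. (x $ i) ^ m)"
proof -
  have nonneg: "0 \<le> x $ i" for i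
    using assms(1) by (simp add: nonneg_orthant_def)
  obtain i where "x $ i \<noteq> 0"
    using assms(2) by (auto simp: vec_eq_iff)
  then have "0 < (x $ i) ^ m"
    using nonneg[of i] by simp
  then show ?thesis
    using nonneg by (intro sum_pos2[of UNIV i]) auto
qed

theorem proposition11:
  fixes k :: nat and A :: "'n::finite tensor" and lam :: real
  assumes "k \<ge> 1"
    and "copositive_tensor k A"
    and "Hplus_eigenvalue k A lam"
  shows "lam \<ge> 0"
proof -
  obtain m where k: "k = Suc m"
    using assms(1) by (cases k) auto
  obtain x where x: "x \<in> nonneg_orthant" "x \<noteq> 0"
    and eig: "tensor_map k A x = lam *\<^sub>R vec_power x m"
    using assms(3) by (auto simp: Hplus_eigenvalue_def k)
  have "0 \<le> tensor_form k A x"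
    using assms(2) x(1) by (simp add: copositive_tensor_def)
  also have "\<dots> = lam * (\<Sum>i\<in>UNIV. (x $ i) ^ Suc m)"
    using eig by (simp only: k tensor_form_Suc inner_scaleR_right inner_vec_power)
  finally show ?thesis
    \<comment> \<open>Positivity of the sum forces the sign of \<open>lam\<close>.\<close>
    using sum_power_pos[OF x, of "Suc m"] by (simp add: zero_le_mult_iff)
qed

end
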